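(* Let $X$ be a $\Delta$-complex and let $u\in H^1(X;\mathbb Z_3)$. Then the Massey triple product $\langle u,u,u\rangle\subseteq H^2(X;\mathbb Z_3)$ contains the element $-\delta(u)$, where $\delta$ is the Bockstein operator associated to the coefficient sequence $0\to\mathbb Z_3\to\mathbb Z_9\to\mathbb Z_3\to0$.
   Context: $\mathbb Z_n=\mathbb Z/n\mathbb Z$. A $\Delta$-complex is the geometric realization of a $\Delta$-set (sets $X_n$ of $n$-simplices with face maps $d_i$ satisfying $d_id_j=d_{j-1}d_i$ for $i<j$). Cochains $C^*(X;\mathbb Z_3)$ are simplicial cochains, with $(du)(x)=u(\partial x)$, $\partial=\sum(-1)^id_i$, and cup product $(u\cup v)([0,\dots,p+q])=u([0,\dots,p])v([p,\dots,p+q])$ for $u\in C^p,v\in C^q$. For $u_1,u_2,u_3\in H^1$ with $u_1u_2=u_2u_3=0$, the Massey triple product $\langle u_1,u_2,u_3\rangle$ is the set of all classes $[a_1\cup a_{2,3}+a_{1,2}\cup a_3]\in H^2$, where $a_i$ are cocycles with $[a_i]=u_i$ and $a_{i,j}$ are $1$-cochains with $da_{i,j}=a_i\cup a_j$. The Bockstein is the connecting homomorphism: if $\tilde a\in C^1(X;\mathbb Z)$ reduces mod $3$ to a cocycle $a$ and $d\tilde a=3\beta$, then $\delta[a]=[\beta \bmod 3]$. *)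

theory Defs
  imports "HOL-Algebra.Coset" "HOL-Library.Numeral_Type"
begin

section \<open>Delta-sets\<close>

text \<open>
  A Delta-complex is represented by its underlying Delta-set; the cohomology used below is
  simplicial, so the geometric realization itself does not enter.  \<open>simplices X n\<close> is the set of
  \<open>n\<close>-simplices, and \<open>face X n i\<close> is the face map \<open>d\<^sub>i\<close> from \<open>n\<close>-simplices to
  \<open>(n - 1)\<close>-simplices; only its values at \<open>n \<ge> 1\<close>, \<open>i \<le> n\<close> on \<open>simplices X n\<close> matter.
\<close>

record 'a delta_data =
  simplices :: "nat \<Rightarrow> 'a set"
  face :: "nat \<Rightarrow> nat \<Rightarrow> 'a \<Rightarrow> 'a"

locale delta_set =
  fixes X :: "'a delta_data"
  assumes face_closed:
      "i \<le> Suc n \<Longrightarrow> x \<in> simplices X (Suc n) \<Longrightarrow> face X (Suc n) i x \<in> simplices X n"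
    and face_face:
      "i < j \<Longrightarrow> j \<le> Suc (Suc n) \<Longrightarrow> x \<in> simplices X (Suc (Suc n)) \<Longrightarrow>
       face X (Suc n) i (face X (Suc (Suc n)) j x) =
       face X (Suc n) (j - 1) (face X (Suc (Suc n)) i x)"

section \<open>Simplicial cochains and cohomology\<close>

text \<open>
  An \<open>n\<close>-cochain is a function on \<open>simplices X n\<close>, extended by zero to the whole type so that
  equality of cochains is equality of functions.
\<close>

definition cochains :: "'a delta_data \<Rightarrow> nat \<Rightarrow> ('a \<Rightarrow> 'r::comm_ring_1) set" where
  "cochains X n = {c. \<forall>x. x \<notin> simplices X n \<longrightarrow> c x = 0}"

definition cobd :: "'a delta_data \<Rightarrow> nat \<Rightarrow> ('a \<Rightarrow> 'r::comm_ring_1) \<Rightarrow> 'a \<Rightarrow> 'r" where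
  "cobd X n c x =
     (if x \<in> simplices X (Suc n) then \<Sum>i\<le>Suc n. (- 1) ^ i * c (face X (Suc n) i x) else 0)"

definition cocycles :: "'a delta_data \<Rightarrow> nat \<Rightarrow> ('a \<Rightarrow> 'r::comm_ring_1) set" where
  "cocycles X n = {c \<in> cochains X n. cobd X n c = (\<lambda>x. 0)}"

definition coboundaries :: "'a delta_data \<Rightarrow> nat \<Rightarrow> ('a \<Rightarrow> 'r::comm_ring_1) set" where
  "coboundaries X n =
     (case n of 0 \<Rightarrow> {\<lambda>x. 0} | Suc m \<Rightarrow> cobd X m ` cochains X m)"

definition cocycle_group :: "'a delta_data \<Rightarrow> nat \<Rightarrow> ('a \<Rightarrow> 'r::comm_ring_1) monoid" where
  "cocycle_group X n =
     \<lparr>carrier = cocycles X n, mult = (\<lambda>a b x. a x + b x), one = (\<lambda>x. 0)\<rparr>"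

text \<open>The group operation of the cohomology group is addition of classes, written
  multiplicatively as always in HOL-Algebra; the coefficient ring is given by the type.\<close>

definition cohomology_group ::
    "'a delta_data \<Rightarrow> nat \<Rightarrow> ('a \<Rightarrow> 'r::comm_ring_1) set monoid" where
  "cohomology_group X n = cocycle_group X n Mod coboundaries X n"

definition coh_class ::
    "'a delta_data \<Rightarrow> nat \<Rightarrow> ('a \<Rightarrow> 'r::comm_ring_1) \<Rightarrow> ('a \<Rightarrow> 'r) set" where
  "coh_class X n a = coboundaries X n #>\<^bsub>cocycle_group X n\<^esub> a"

section \<open>Cup product\<close>

text \<open>
  For a simplex \<open>x = [0,\<dots>,p+q]\<close>: \<open>front_face X p q x = [0,\<dots>,p]\<close>, obtained by deleting the
  last vertex \<open>q\<close> times, and \<open>back_face X p q x = [p,\<dots>,p+q]\<close>, obtained by deleting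
  vertex \<open>0\<close> \<open>p\<close> times.
\<close>

primrec front_face :: "'a delta_data \<Rightarrow> nat \<Rightarrow> nat \<Rightarrow> 'a \<Rightarrow> 'a" where
  "front_face X p 0 x = x"
| "front_face X p (Suc q) x = front_face X p q (face X (p + Suc q) (p + Suc q) x)"

primrec back_face :: "'a delta_data \<Rightarrow> nat \<Rightarrow> nat \<Rightarrow> 'a \<Rightarrow> 'a" where
  "back_face X 0 q x = x"
| "back_face X (Suc p) q x = back_face X p q (face X (Suc p + q) 0 x)"

definition cup ::
    "'a delta_data \<Rightarrow> nat \<Rightarrow> nat \<Rightarrow> ('a \<Rightarrow> 'r::comm_ring_1) \<Rightarrow> ('a \<Rightarrow> 'r) \<Rightarrow> 'a \<Rightarrow> 'r" where
  "cup X p q a b x =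
     (if x \<in> simplices X (p + q) then a (front_face X p q x) * b (back_face X p q x) else 0)"

section \<open>Massey triple products of degree one classes\<close>

text \<open>
  If \<open>u1 u2\<close> or \<open>u2 u3\<close> is nonzero, the triple product is undefined in the usual terminology and
  empty here.  In particular, membership of any class includes the vanishing of \<open>u1 u2\<close> and \<open>u2 u3\<close>.
\<close>

definition massey3 ::
    "'a delta_data \<Rightarrow> ('a \<Rightarrow> 'r::comm_ring_1) set \<Rightarrow> ('a \<Rightarrow> 'r) set \<Rightarrow> ('a \<Rightarrow> 'r) set
      \<Rightarrow> ('a \<Rightarrow> 'r) set set" where
  "massey3 X u1 u2 u3 =
     {coh_class X 2 (\<lambda>x. cup X 1 1 a1 a23 x + cup X 1 1 a12 a3 x) | a1 a2 a3 a12 a23.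
        a1 \<in> cocycles X 1 \<and> a2 \<in> cocycles X 1 \<and> a3 \<in> cocycles X 1 \<and>
        coh_class X 1 a1 = u1 \<and> coh_class X 1 a2 = u2 \<and> coh_class X 1 a3 = u3 \<and>
        a12 \<in> cochains X 1 \<and> a23 \<in> cochains X 1 \<and>
        cobd X 1 a12 = cup X 1 1 a1 a2 \<and> cobd X 1 a23 = cup X 1 1 a2 a3}"

section \<open>Connecting homomorphism and Bockstein operator\<close>

text \<open>
  The connecting homomorphism of a short exact coefficient sequence with maps \<open>\<iota>\<close> and \<open>\<pi>\<close>:
  lift a representing cocycle along \<open>\<pi>\<close>, take the coboundary, and divide by \<open>\<iota>\<close>.
\<close>

definition connecting_hom ::
    "('r::comm_ring_1 \<Rightarrow> 's::comm_ring_1) \<Rightarrow> ('s \<Rightarrow> 't::comm_ring_1) \<Rightarrow> 'a delta_data \<Rightarrow> nat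
      \<Rightarrow> ('a \<Rightarrow> 't) set \<Rightarrow> ('a \<Rightarrow> 'r) set" where
  "connecting_hom \<iota> \<pi> X n u =
     (THE v. \<exists>a \<in> cocycles X n. \<exists>c \<in> cochains X n. \<exists>b \<in> cochains X (Suc n).
        coh_class X n a = u \<and> \<pi> \<circ> c = a \<and> cobd X n c = \<iota> \<circ> b \<and> v = coh_class X (Suc n) b)"

text \<open>\<open>Rep_bit1\<close> is the least nonnegative integer representative of a residue class; the type
  \<open>3\<close> is the ring \<open>\<int>/3\<close> and \<open>9\<close> is \<open>\<int>/9\<close>.\<close>

definition incl_3_9 :: "3 \<Rightarrow> 9" where
  "incl_3_9 x = 3 * of_int (Rep_bit1 x)"

definition red_9_3 :: "9 \<Rightarrow> 3" where
  "red_9_3 y = of_int (Rep_bit1 y)"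

definition bockstein :: "'a delta_data \<Rightarrow> nat \<Rightarrow> ('a \<Rightarrow> 3) set \<Rightarrow> ('a \<Rightarrow> 3) set" where
  "bockstein = connecting_hom incl_3_9 red_9_3"

section \<open>Well-definedness\<close>

lemma Rep_of_int_3: "Rep_bit1 (of_int k :: 3) = k mod 3"
  using bit1.Rep_Abs_mod[where 'a = num1, of k] by (simp add: bit1.of_int_eq)

lemma Rep_of_int_9: "Rep_bit1 (of_int k :: 9) = k mod 9"
  using bit1.Rep_Abs_mod[where 'a = "num1 bit0 bit0", of k] by (simp add: bit1.of_int_eq)

lemma of_int_3_eq_iff: "(of_int k :: 3) = of_int l \<longleftrightarrow> k mod 3 = l mod 3"
  by (simp only: Rep_of_int_3[symmetric] Rep_bit1_inject)

lemma of_int_9_eq_iff: "(of_int k :: 9) = of_int l \<longleftrightarrow> k mod 9 = l mod 9"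
  by (simp only: Rep_of_int_9[symmetric] Rep_bit1_inject)

lemma of_int_Rep_3 [simp]: "of_int (Rep_bit1 (x::3)) = x"
  by (simp only: bit1.of_int_eq bit1.Rep_mod bit1.Rep_inverse)

lemma of_int_Rep_9 [simp]: "of_int (Rep_bit1 (x::9)) = x"
  by (simp only: bit1.of_int_eq bit1.Rep_mod bit1.Rep_inverse)

lemma incl_3_9_of_int: "incl_3_9 (of_int k) = of_int (3 * k)"
proof -
  have "(of_int (3 * (k mod 3)) :: 9) = of_int (3 * k)"
    unfolding of_int_9_eq_iff by presburger
  then show ?thesis by (simp add: incl_3_9_def Rep_of_int_3)
qed

lemma red_9_3_of_int: "red_9_3 (of_int k) = of_int k"
  unfolding red_9_3_def Rep_of_int_9 of_int_3_eq_iff by presburger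

lemma incl_3_9_diff: "incl_3_9 (x - y) = incl_3_9 x - incl_3_9 y"
  using incl_3_9_of_int[of "Rep_bit1 x"] incl_3_9_of_int[of "Rep_bit1 y"]
    incl_3_9_of_int[of "Rep_bit1 x - Rep_bit1 y"]
  by (simp only: of_int_diff of_int_Rep_3 right_diff_distrib)

lemma red_9_3_diff: "red_9_3 (x - y) = red_9_3 x - red_9_3 y"
  using red_9_3_of_int[of "Rep_bit1 x"] red_9_3_of_int[of "Rep_bit1 y"]
    red_9_3_of_int[of "Rep_bit1 x - Rep_bit1 y"]
  by (simp only: of_int_diff of_int_Rep_9)

text \<open>Exactness of \<open>0 \<rightarrow> \<int>/3 \<rightarrow> \<int>/9 \<rightarrow> \<int>/3 \<rightarrow> 0\<close>.\<close>

lemma inj_incl_3_9: "inj incl_3_9"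
proof (rule injI)
  fix x y :: 3
  assume eq: "incl_3_9 x = incl_3_9 y"
  obtain k l where kl: "x = of_int k" "y = of_int l" by (metis of_int_Rep_3)
  with eq have "(3 * k) mod 9 = (3 * l) mod 9"
    by (simp only: incl_3_9_of_int of_int_9_eq_iff)
  then have "k mod 3 = l mod 3" by presburger
  then show "x = y" by (simp only: kl of_int_3_eq_iff)
qed

lemma surj_red_9_3: "surj red_9_3"
proof (rule surjI)
  show "red_9_3 (of_int (Rep_bit1 x)) = x" for x
    by (simp only: red_9_3_of_int of_int_Rep_3)
qed

lemma range_incl_3_9: "range incl_3_9 = {y. red_9_3 y = 0}"
proof (rule Set.set_eqI, rule iffI)
  fix y assume "y \<in> range incl_3_9"
  then obtain k where "y = of_int (3 * k)" by (metis imageE incl_3_9_of_int of_int_Rep_3)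
  then have "red_9_3 y = of_int (3 * k)" by (simp only: red_9_3_of_int)
  also have "\<dots> = of_int 0" by (simp only: of_int_3_eq_iff) simp
  finally show "y \<in> {y. red_9_3 y = 0}" by simp
next
  fix y :: 9 assume y: "y \<in> {y. red_9_3 y = 0}"
  obtain l where l: "y = of_int l" by (metis of_int_Rep_9)
  with y have "(of_int l :: 3) = of_int 0" by (simp add: red_9_3_of_int)
  then have "l mod 3 = 0" by (simp only: of_int_3_eq_iff) simp
  then obtain k where "l = 3 * k" by (metis mod_0_imp_dvd dvdE)
  then have "y = incl_3_9 (of_int k)" by (simp only: l incl_3_9_of_int)
  then show "y \<in> range incl_3_9" by simp
qed

lemma zero_in_cochains: "(\<lambda>x. 0) \<in> cochains X n"
  by (simp add: cochains_def)

lemma cochains_add: "a \<in> cochains X n \<Longrightarrow> b \<in> cochains X n \<Longrightarrow> (\<lambda>x. a x + b x) \<in> cochains X n"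
  by (simp add: cochains_def)

lemma cochains_diff: "a \<in> cochains X n \<Longrightarrow> b \<in> cochains X n \<Longrightarrow> (\<lambda>x. a x - b x) \<in> cochains X n"
  by (simp add: cochains_def)

lemma cochains_uminus: "a \<in> cochains X n \<Longrightarrow> (\<lambda>x. - a x) \<in> cochains X n"
  by (simp add: cochains_def)

lemma cobd_in_cochains: "cobd X n c \<in> cochains X (Suc n)"
  by (simp add: cochains_def cobd_def)

lemma cup_in_cochains: "cup X p q a b \<in> cochains X (p + q)"
  by (simp add: cochains_def cup_def)

lemma cobd_add: "cobd X n (\<lambda>x. a x + b x) = (\<lambda>x. cobd X n a x + cobd X n b x)"
  by (simp only: cobd_def fun_eq_iff distrib_left sum.distrib) simp

lemma cobd_diff: "cobd X n (\<lambda>x. a x - b x) = (\<lambda>x. cobd X n a x - cobd X n b x)"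
  by (simp only: cobd_def fun_eq_iff right_diff_distrib sum_subtractf) simp

lemma cobd_uminus: "cobd X n (\<lambda>x. - a x) = (\<lambda>x. - cobd X n a x)"
  by (simp only: cobd_def fun_eq_iff mult_minus_right sum_negf) simp

lemma cobd_zero: "cobd X n (\<lambda>x. 0) = (\<lambda>x. 0)"
  by (simp add: cobd_def fun_eq_iff)

lemma cobd_comp:
  assumes h: "\<And>x y. h (x - y) = h x - h y"
  shows "cobd X n (h \<circ> c) = h \<circ> cobd X n c"
proof -
  have h0: "h 0 = 0" using h[of 0 0] by simp
  have hm: "h (- x) = - h x" for x using h[of 0 x] h0 by simp
  have ha: "h (x + y) = h x + h y" for x y using h[of x "- y"] hm by simp
  have hs: "h (sum f A) = (\<Sum>i\<in>A. h (f i))" if "finite A" for f and A :: "nat set"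
    using that by (induction A rule: finite_induct) (simp_all add: h0 ha)
  have hp: "h ((- 1) ^ i * x) = (- 1) ^ i * h x" for i x
    by (induction i) (simp_all add: hm)
  show ?thesis
    by (simp only: cobd_def fun_eq_iff comp_def) (simp only: h0 hs hp finite_atMost split: if_split, simp)
qed

context delta_set
begin

lemma cobd_cobd: "cobd X (Suc n) (cobd X n c) = (\<lambda>x. 0)"
proof
  fix x
  show "cobd X (Suc n) (cobd X n c) x = 0"
  proof (cases "x \<in> simplices X (Suc (Suc n))")
    case True
    define g where "g = (\<lambda>(j, i). (- 1) ^ j * ((- 1) ^ i *
      c (face X (Suc n) i (face X (Suc (Suc n)) j x))))"
    define I where "I = {..Suc (Suc n)} \<times> {..Suc n}"
    define L where "L = {(j, i) \<in> I. i < j}"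
    define U where "U = {(j, i) \<in> I. j \<le> i}"
    have "cobd X (Suc n) (cobd X n c) x = (\<Sum>j\<le>Suc (Suc n). \<Sum>i\<le>Suc n. g (j, i))"
      using True by (auto simp: cobd_def g_def face_closed sum_distrib_left simp del: sum.atMost_Suc
          intro!: sum.cong)
    also have "\<dots> = sum g I" by (simp only: I_def sum.cartesian_product) simp
    also have "I = L \<union> U" by (auto simp: I_def L_def U_def)
    also have "sum g (L \<union> U) = sum g L + sum g U"
    proof (rule sum.union_disjoint)
      have "finite I" by (simp add: I_def)
      then show "finite L" "finite U" by (auto simp: L_def U_def intro: finite_subset)
      show "L \<inter> U = {}" by (auto simp: L_def U_def)
    qed
    also have "sum g L = (\<Sum>z\<in>U. - g z)"
    proof (rule sum.reindex_bij_witness[of _ "\<lambda>(j, i). (Suc i, j)" "\<lambda>(j, i). (i, j - 1)"])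
      fix z assume "z \<in> L"
      then obtain j i where z: "z = (j, i)" "i < j" "j \<le> Suc (Suc n)"
        by (auto simp: L_def I_def)
      then obtain k where k: "j = Suc k" by (cases j) auto
      show "- g ((\<lambda>(j, i). (i, j - 1)) z) = g z"
        using face_face[of i j n x] True z by (simp add: g_def k)
    qed (auto simp: L_def U_def I_def)
    also have "\<dots> + sum g U = 0" by (simp add: sum_negf)
    finally show ?thesis .
  qed (simp add: cobd_def)
qed

lemma coboundaries_subset_cocycles: "coboundaries X n \<subseteq> cocycles X n"
  by (cases n)
    (auto simp: coboundaries_def cocycles_def cobd_cobd cobd_in_cochains zero_in_cochains cobd_zero)

lemma comm_group_cocycle_group: "comm_group (cocycle_group X n)"
proof (rule comm_groupI)
  fix a assume "a \<in> carrier (cocycle_group X n)"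
  then show "\<exists>b\<in>carrier (cocycle_group X n). b \<otimes>\<^bsub>cocycle_group X n\<^esub> a = \<one>\<^bsub>cocycle_group X n\<^esub>"
    by (intro bexI[of _ "\<lambda>x. - a x"])
      (auto simp: cocycle_group_def cocycles_def cochains_uminus cobd_uminus)
qed (auto simp: cocycle_group_def cocycles_def zero_in_cochains cochains_add cobd_add cobd_zero
    add.assoc add.commute)

lemma inv_cocycle_group:
  assumes "a \<in> cocycles X n"
  shows "inv\<^bsub>cocycle_group X n\<^esub> a = (\<lambda>x. - a x)"
proof -
  interpret comm_group "cocycle_group X n" by (rule comm_group_cocycle_group)
  show ?thesis
    by (rule inv_equality)
      (use assms in \<open>auto simp: cocycle_group_def cocycles_def cochains_uminus cobd_uminus\<close>)
qed

lemma coboundaries_normal: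
  "(coboundaries X n :: ('a \<Rightarrow> 'b::comm_ring_1) set) \<lhd> cocycle_group X n"
proof -
  interpret comm_group "cocycle_group X n :: ('a \<Rightarrow> 'b) monoid"
    by (rule comm_group_cocycle_group)
  have "subgroup (coboundaries X n :: ('a \<Rightarrow> 'b) set) (cocycle_group X n)"
  proof
    show "coboundaries X n \<subseteq> carrier (cocycle_group X n)"
      using coboundaries_subset_cocycles by (simp add: cocycle_group_def)
    show "\<one>\<^bsub>cocycle_group X n\<^esub> \<in> coboundaries X n"
      by (cases n) (auto simp: cocycle_group_def coboundaries_def zero_in_cochains
          intro!: image_eqI[of _ _ "\<lambda>x. 0"] cobd_zero[symmetric])
  next
    fix a b :: "'a \<Rightarrow> 'b" assume "a \<in> coboundaries X n" "b \<in> coboundaries X n"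
    then show "a \<otimes>\<^bsub>cocycle_group X n\<^esub> b \<in> coboundaries X n"
      by (cases n) (auto simp: cocycle_group_def coboundaries_def cobd_add[symmetric] cochains_add)
  next
    fix a :: "'a \<Rightarrow> 'b" assume a: "a \<in> coboundaries X n"
    then have "inv\<^bsub>cocycle_group X n\<^esub> a = (\<lambda>x. - a x)"
      using coboundaries_subset_cocycles inv_cocycle_group by blast
    with a show "inv\<^bsub>cocycle_group X n\<^esub> a \<in> coboundaries X n"
      by (cases n) (auto simp: coboundaries_def cobd_uminus[symmetric] cochains_uminus)
  qed
  then show ?thesis by (rule subgroup_imp_normal)
qed

lemma comm_group_cohomology_group: "comm_group (cohomology_group X n)"
  unfolding cohomology_group_def
  by (intro comm_group.abelian_FactGroup comm_group_cocycle_group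
      normal_imp_subgroup coboundaries_normal)

lemma carrier_cohomology_group:
  "carrier (cohomology_group X n) = coh_class X n ` cocycles X n"
  by (simp add: cohomology_group_def carrier_FactGroup coh_class_def cocycle_group_def image_def)

lemma coh_class_eq_iff:
  assumes "a \<in> cocycles X n" "b \<in> cocycles X n"
  shows "coh_class X n a = coh_class X n b \<longleftrightarrow> (\<lambda>x. a x - b x) \<in> coboundaries X n"
proof -
  interpret normal "coboundaries X n" "cocycle_group X n" by (rule coboundaries_normal)
  have ab: "a \<in> carrier (cocycle_group X n)" "b \<in> carrier (cocycle_group X n)"
    using assms by (simp_all add: cocycle_group_def)
  have "coh_class X n a = coh_class X n b \<longleftrightarrow> a \<in> coboundaries X n #>\<^bsub>cocycle_group X n\<^esub> b"
    unfolding coh_class_def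
    using rcos_self[OF ab(1) subgroup_axioms] repr_independence[OF _ ab(2) subgroup_axioms] by auto
  also have "\<dots> \<longleftrightarrow>
      a \<otimes>\<^bsub>cocycle_group X n\<^esub> inv\<^bsub>cocycle_group X n\<^esub> b \<in> coboundaries X n"
    by (rule rcos_module[OF is_group ab(2,1)])
  finally show ?thesis
    using assms by (simp add: inv_cocycle_group) (simp add: cocycle_group_def)
qed

lemma coh_class_mult:
  assumes "a \<in> cocycles X n" "b \<in> cocycles X n"
  shows "coh_class X n a \<otimes>\<^bsub>cohomology_group X n\<^esub> coh_class X n b = coh_class X n (\<lambda>x. a x + b x)"
proof -
  interpret normal "coboundaries X n" "cocycle_group X n" by (rule coboundaries_normal)
  show ?thesis
    using rcos_sum[of a b] assms
    by (simp add: cohomology_group_def coh_class_def) (simp add: cocycle_group_def)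
qed

lemma inv_coh_class:
  assumes "a \<in> cocycles X n"
  shows "inv\<^bsub>cohomology_group X n\<^esub> coh_class X n a = coh_class X n (\<lambda>x. - a x)"
proof -
  interpret normal "coboundaries X n" "cocycle_group X n" by (rule coboundaries_normal)
  have "inv\<^bsub>cohomology_group X n\<^esub> coh_class X n a = set_inv\<^bsub>cocycle_group X n\<^esub> coh_class X n a"
    unfolding cohomology_group_def
    by (rule inv_FactGroup)
      (use assms in \<open>auto simp: carrier_FactGroup coh_class_def cocycle_group_def\<close>)
  also have "\<dots> = coh_class X n (inv\<^bsub>cocycle_group X n\<^esub> a)"
    unfolding coh_class_def by (rule rcos_inv) (use assms in \<open>simp add: cocycle_group_def\<close>)
  finally show ?thesis using assms by (simp add: inv_cocycle_group)
qed

lemma massey3_subset: "massey3 X u1 u2 u3 \<subseteq> carrier (cohomology_group X 2)"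
proof
  fix v assume "v \<in> massey3 X u1 u2 u3"
  then obtain a1 a2 a3 a12 a23 where
    cyc: "a1 \<in> cocycles X 1" "a3 \<in> cocycles X 1" and
    d12: "cobd X 1 a12 = cup X 1 1 a1 a2" and d23: "cobd X 1 a23 = cup X 1 1 a2 a3" and
    v: "v = coh_class X 2 (\<lambda>x. cup X 1 1 a1 a23 x + cup X 1 1 a12 a3 x)"
    unfolding massey3_def by blast
  let ?f = "\<lambda>x. cup X 1 1 a1 a23 x + cup X 1 1 a12 a3 x"
  have cobd2: "cobd X 1 c y = c (face X 2 0 y) - c (face X 2 1 y) + c (face X 2 2 y)"
    if "y \<in> simplices X 2" for y and c :: "'a \<Rightarrow> 'b"
    using that by (simp add: cobd_def numeral_2_eq_2)
  have cup2: "cup X 1 1 c e y = c (face X 2 2 y) * e (face X 2 0 y)"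
    if "y \<in> simplices X 2" for y and c e :: "'a \<Rightarrow> 'b"
    using that by (simp add: cup_def numeral_2_eq_2)
  have "cobd X 2 ?f x = 0" for x
  proof (cases "x \<in> simplices X 3")
    case True
    define e where "e = (\<lambda>i. face X 3 i x)"
    have e: "e i \<in> simplices X 2" if "i \<le> 3" for i
      using face_closed[of i 2 x] that True by (simp add: e_def numeral_3_eq_3 numeral_2_eq_2)
    have ff: "face X 2 i (e j) = face X 2 (j - 1) (e i)" if "i < j" "j \<le> 3" for i j
      using face_face[of i j 1 x] that True by (simp add: e_def numeral_3_eq_3 numeral_2_eq_2)
    have ff': "face X 2 0 (e 1) = face X 2 0 (e 0)" "face X 2 0 (e 2) = face X 2 1 (e 0)"
      "face X 2 0 (e 3) = face X 2 2 (e 0)" "face X 2 1 (e 2) = face X 2 1 (e 1)"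
      "face X 2 1 (e 3) = face X 2 2 (e 1)" "face X 2 2 (e 3) = face X 2 2 (e 2)"
      using ff[of 0 1] ff[of 0 2] ff[of 0 3] ff[of 1 2] ff[of 1 3] ff[of 2 3] by simp_all
    have "cobd X 2 ?f x = ?f (e 0) - ?f (e 1) + ?f (e 2) - ?f (e 3)"
      using True by (simp add: cobd_def e_def numeral_3_eq_3 numeral_2_eq_2)
    also have "\<dots> = 0"
    proof -
      have c1: "a1 (face X 2 2 (e 1)) = a1 (face X 2 2 (e 0)) + a1 (face X 2 2 (e 2))"
        using cyc(1) cobd2[OF e, of 3 a1] by (simp add: cocycles_def ff' algebra_simps del: One_nat_def)
      have c3: "a3 (face X 2 1 (e 0)) = a3 (face X 2 0 (e 0)) + a3 (face X 2 2 (e 0))"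
        using cyc(2) cobd2[OF e, of 0 a3] by (simp add: cocycles_def algebra_simps del: One_nat_def)
      have c12: "a12 (face X 2 2 (e 1)) = a12 (face X 2 2 (e 0)) + a12 (face X 2 2 (e 2))
          - a1 (face X 2 2 (e 2)) * a2 (face X 2 2 (e 0))"
        using fun_cong[OF d12, of "e 3"] cobd2[OF e, of 3 a12] cup2[OF e, of 3 a1 a2]
        by (simp add: ff' algebra_simps del: One_nat_def)
      have c23: "a23 (face X 2 1 (e 0)) = a23 (face X 2 0 (e 0)) + a23 (face X 2 2 (e 0))
          - a2 (face X 2 2 (e 0)) * a3 (face X 2 0 (e 0))"
        using fun_cong[OF d23, of "e 0"] cobd2[OF e, of 0 a23] cup2[OF e, of 0 a2 a3]
        by (simp add: algebra_simps del: One_nat_def)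
      show ?thesis
        by (simp add: cup2[OF e] ff' c1 c3 c12 c23 algebra_simps del: One_nat_def)
    qed
    finally show ?thesis .
  next
    case False
    then show ?thesis by (simp add: cobd_def numeral_3_eq_3 numeral_2_eq_2)
  qed
  moreover have "?f \<in> cochains X 2"
    using cochains_add[OF cup_in_cochains cup_in_cochains, of X 1 1] by (simp add: numeral_2_eq_2)
  ultimately show "v \<in> carrier (cohomology_group X 2)"
    using v by (auto simp: carrier_cohomology_group cocycles_def fun_eq_iff)
qed

text \<open>The description \<open>THE\<close> in \<^const>\<open>connecting_hom\<close> is legitimate.\<close>

lemma bockstein_eqI:
  assumes a: "a \<in> cocycles X n" and c: "c \<in> cochains X n" and b: "b \<in> cochains X (Suc n)"
    and ca: "red_9_3 \<circ> c = a" and cb: "cobd X n c = incl_3_9 \<circ> b"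
  shows "b \<in> cocycles X (Suc n)" "bockstein X n (coh_class X n a) = coh_class X (Suc n) b"
proof -
  have i0: "incl_3_9 0 = 0" using incl_3_9_diff[of 0 0] by simp
  have r0: "red_9_3 0 = 0" using red_9_3_diff[of 0 0] by simp
  have inc0: "f = (\<lambda>x. 0)" if "incl_3_9 \<circ> f = (\<lambda>x. 0)" for f :: "'a \<Rightarrow> 3"
    using that i0 inj_incl_3_9 by (auto simp: fun_eq_iff inj_def)
  have cyc: "b \<in> cocycles X (Suc n)"
    if "c \<in> cochains X n" "b \<in> cochains X (Suc n)" "cobd X n c = incl_3_9 \<circ> b" for b c
  proof -
    have "incl_3_9 \<circ> cobd X (Suc n) b = (\<lambda>x. 0)"
      using cobd_cobd[of n c] that(3) cobd_comp[of incl_3_9, OF incl_3_9_diff] by metis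
    then show ?thesis using inc0 that by (simp add: cocycles_def)
  qed
  show bc: "b \<in> cocycles X (Suc n)" using cyc c b cb by blast
  show "bockstein X n (coh_class X n a) = coh_class X (Suc n) b"
    unfolding bockstein_def connecting_hom_def
  proof (rule the_equality)
    show "\<exists>a'\<in>cocycles X n. \<exists>c\<in>cochains X n. \<exists>b'\<in>cochains X (Suc n).
       coh_class X n a' = coh_class X n a \<and> red_9_3 \<circ> c = a' \<and> cobd X n c = incl_3_9 \<circ> b' \<and>
       coh_class X (Suc n) b = coh_class X (Suc n) b'"
      using assms by blast
  next
    fix v
    assume "\<exists>a'\<in>cocycles X n. \<exists>c\<in>cochains X n. \<exists>b\<in>cochains X (Suc n).
       coh_class X n a' = coh_class X n a \<and> red_9_3 \<circ> c = a' \<and> cobd X n c = incl_3_9 \<circ> b \<and>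
       v = coh_class X (Suc n) b"
    then obtain a' c' b' where a': "a' \<in> cocycles X n" and c': "c' \<in> cochains X n"
      and b': "b' \<in> cochains X (Suc n)" and cl: "coh_class X n a' = coh_class X n a"
      and ca': "red_9_3 \<circ> c' = a'" and cb': "cobd X n c' = incl_3_9 \<circ> b'"
      and v: "v = coh_class X (Suc n) b'" by blast
    have "(\<lambda>x. a' x - a x) \<in> coboundaries X n"
      using cl coh_class_eq_iff[OF a' a] by simp
    then have "\<exists>f::'a \<Rightarrow> 9. f \<in> cochains X n \<and> cobd X n f = (\<lambda>x. 0) \<and> red_9_3 \<circ> f = (\<lambda>x. a' x - a x)"
    proof (cases n)
      case 0
      assume "(\<lambda>x. a' x - a x) \<in> coboundaries X n"
      with 0 have "(\<lambda>x. a' x - a x) = (\<lambda>x. 0)" by (simp add: coboundaries_def)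
      then show ?thesis
        by (intro exI[of _ "\<lambda>x. 0"]) (simp add: r0 zero_in_cochains cobd_zero comp_def)
    next
      case (Suc m)
      assume "(\<lambda>x. a' x - a x) \<in> coboundaries X n"
      with Suc obtain e where e: "e \<in> cochains X m" "(\<lambda>x. a' x - a x) = cobd X m e"
        by (auto simp: coboundaries_def)
      define f :: "'a \<Rightarrow> 9" where "f = (\<lambda>x. of_int (Rep_bit1 (e x)))"
      have re: "red_9_3 \<circ> f = e" by (simp add: f_def fun_eq_iff red_9_3_of_int)
      show ?thesis
        using cobd_comp[of red_9_3 X m f, OF red_9_3_diff] e re Suc
        by (intro exI[of _ "cobd X m f"]) (simp add: cobd_cobd cobd_in_cochains)
    qed
    then obtain f :: "'a \<Rightarrow> 9" where f: "f \<in> cochains X n" "cobd X n f = (\<lambda>x. 0)"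
      "red_9_3 \<circ> f = (\<lambda>x. a' x - a x)" by blast
    define g where "g = (\<lambda>x. (c' x - c x) - f x)"
    have g: "g \<in> cochains X n" unfolding g_def by (intro cochains_diff c c' f)
    have "red_9_3 (g x) = 0" for x
      using ca ca' fun_cong[OF f(3), of x] by (auto simp: g_def red_9_3_diff)
    then have "\<exists>y. g x = incl_3_9 y" for x using range_incl_3_9 by blast
    then obtain h where h: "g x = incl_3_9 (h x)" for x by metis
    have "h \<in> cochains X n"
      using g h i0 inj_incl_3_9 by (auto simp: cochains_def inj_def)
    moreover have "(\<lambda>x. b' x - b x) = cobd X n h"
    proof
      fix x
      have "g = incl_3_9 \<circ> h" using h by (simp add: fun_eq_iff)
      then have "incl_3_9 (cobd X n h x) = cobd X n g x"
        using cobd_comp[of incl_3_9 X n h, OF incl_3_9_diff] by simp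
      also have "\<dots> = incl_3_9 (b' x - b x)"
        by (simp add: g_def cobd_diff f cb cb' incl_3_9_diff)
      finally show "b' x - b x = cobd X n h x" using inj_incl_3_9 by (simp add: inj_eq)
    qed
    ultimately have "(\<lambda>x. b' x - b x) \<in> coboundaries X (Suc n)" by (simp add: coboundaries_def)
    then show "v = coh_class X (Suc n) b"
      using coh_class_eq_iff[OF cyc[OF c' b' cb'] bc] v by simp
  qed
qed

text \<open>The Bockstein operator is also computed from integral lifts: if \<open>c\<close> lifts \<open>a\<close> and
  \<open>\<delta>c = 3b\<close>, then the Bockstein operator maps the class of \<open>a\<close> to the class of \<open>b\<close> modulo \<open>3\<close>.\<close>

lemma bockstein_integral_lift:
  fixes c b :: "'a \<Rightarrow> int"
  assumes a: "a \<in> cocycles X n" and c: "c \<in> cochains X n" and b: "b \<in> cochains X (Suc n)"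
    and ca: "of_int \<circ> c = a" and cb: "cobd X n c = (\<lambda>x. 3 * b x)"
  shows "bockstein X n (coh_class X n a) = coh_class X (Suc n) (of_int \<circ> b)"
proof (rule bockstein_eqI(2)[OF a, of "of_int \<circ> c"])
  show "(of_int \<circ> c :: 'a \<Rightarrow> 9) \<in> cochains X n" using c by (simp add: cochains_def)
  show "of_int \<circ> b \<in> cochains X (Suc n)" using b by (simp add: cochains_def)
  show "red_9_3 \<circ> (of_int \<circ> c) = a" using ca by (auto simp: red_9_3_of_int)
  have "cobd X n (of_int \<circ> c :: 'a \<Rightarrow> 9) = of_int \<circ> cobd X n c"
    by (rule cobd_comp) simp
  also have "\<dots> = incl_3_9 \<circ> (of_int \<circ> b)"
    by (simp only: cb comp_def incl_3_9_of_int)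
  finally show "cobd X n (of_int \<circ> c) = incl_3_9 \<circ> (of_int \<circ> b)" .
qed

lemma bockstein_closed:
  assumes "u \<in> carrier (cohomology_group X n)"
  shows "bockstein X n u \<in> carrier (cohomology_group X (Suc n))"
proof -
  obtain a where a: "a \<in> cocycles X n" "u = coh_class X n a"
    using assms by (auto simp: carrier_cohomology_group)
  define c :: "'a \<Rightarrow> 9" where "c = (\<lambda>x. of_int (Rep_bit1 (a x)))"
  have ca: "red_9_3 \<circ> c = a" by (simp add: c_def fun_eq_iff red_9_3_of_int)
  have c: "c \<in> cochains X n"
    using a by (auto simp: c_def cochains_def cocycles_def bit1.Rep_0)
  have "red_9_3 \<circ> cobd X n c = (\<lambda>x. 0)"
    using cobd_comp[of red_9_3 X n c, OF red_9_3_diff] a ca by (simp add: cocycles_def)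
  then have "\<exists>y. cobd X n c x = incl_3_9 y" for x
    using range_incl_3_9 by (auto simp: fun_eq_iff)
  then obtain b where b: "cobd X n c x = incl_3_9 (b x)" for x by metis
  have i0: "incl_3_9 0 = 0" using incl_3_9_diff[of 0 0] by simp
  have "b \<in> cochains X (Suc n)"
    using cobd_in_cochains[of X n c] b i0 inj_incl_3_9 by (auto simp: cochains_def inj_def)
  moreover have "cobd X n c = incl_3_9 \<circ> b" using b by auto
  ultimately show ?thesis
    using bockstein_eqI[OF a(1) c _ ca] a(2) by (auto simp: carrier_cohomology_group)
qed

end

end

theory Submission
  imports Defs
begin

text \<open>
  Represent \<open>u\<close> by a cocycle \<open>a\<close> and consider a \<open>2\<close>-simplex with \<open>p = a[0,1]\<close> and \<open>q = a[1,2]\<close>,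
  so that \<open>a[0,2] = p + q\<close>.

  The pointwise square of \<open>a\<close> satisfies \<open>d(a\<^sup>2) = q\<^sup>2 - (p + q)\<^sup>2 + p\<^sup>2 = -2pq = pq\<close> modulo \<open>3\<close>, that is,
  \<open>d(a\<^sup>2)\<close> is the cup product of \<open>a\<close> with itself.  With \<open>a\<^sup>2\<close> as both bounding cochains, the triple product \<open>\<langle>u,u,u\<rangle>\<close> contains the
  class of the cocycle with value \<open>pq\<^sup>2 + p\<^sup>2q = pq(p + q)\<close>.

  On the other hand, cubing an integer representative gives a well-defined map \<open>\<int>/3 \<rightarrow> \<int>/9\<close>, which is
  a section of the reduction since \<open>x\<^sup>3 = x\<close> in \<open>\<int>/3\<close> (it is the Teichmueller lift).  The cochain
  obtained by lifting \<open>a\<close> along it has coboundary \<open>q\<^sup>3 - (p + q)\<^sup>3 + p\<^sup>3 = -3pq(p + q)\<close> modulo \<open>9\<close>.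
  Hence \<open>-\<delta>(u)\<close> is represented by the very same cocycle \<open>pq(p + q)\<close>.
\<close>

lemma cobd_1:
  "x \<in> simplices X 2 \<Longrightarrow> cobd X 1 c x = c (face X 2 0 x) - c (face X 2 1 x) + c (face X 2 2 x)"
  by (simp add: cobd_def numeral_2_eq_2)

lemma cup_1_1:
  "x \<in> simplices X 2 \<Longrightarrow> cup X 1 1 a b x = a (face X 2 2 x) * b (face X 2 0 x)"
  by (simp add: cup_def numeral_2_eq_2)

lemma cocycle_1:
  assumes "a \<in> cocycles X 1" "x \<in> simplices X 2"
  shows "a (face X 2 1 x) = a (face X 2 2 x) + a (face X 2 0 x)"
proof -
  have "cobd X 1 a x = 0" using assms(1) by (simp add: cocycles_def)
  then show ?thesis by (simp only: cobd_1[OF assms(2)]) (simp add: algebra_simps)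
qed

lemma cobd_square:
  assumes a: "(a :: 'a \<Rightarrow> 3) \<in> cocycles X 1"
  shows "cobd X 1 (\<lambda>x. a x ^ 2) = cup X 1 1 a a"
proof
  fix x
  show "cobd X 1 (\<lambda>x. a x ^ 2) x = cup X 1 1 a a x"
  proof (cases "x \<in> simplices X 2")
    case True
    have "q ^ 2 - (p + q) ^ 2 + p ^ 2 = p * q" for p q :: 3
    proof -
      have "q ^ 2 - (p + q) ^ 2 + p ^ 2 = p * q - 3 * (p * q)"
        by (simp add: power2_eq_square algebra_simps)
      moreover have "(3 :: 3) = 0" using of_int_3_eq_iff[of 3 0] by simp
      ultimately show ?thesis by (simp only: mult_zero_left diff_zero)
    qed
    then show ?thesis by (simp only: cobd_1[OF True] cup_1_1[OF True] cocycle_1[OF a True])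
  qed (simp add: cobd_def cup_def numeral_2_eq_2)
qed

text \<open>The multiplicative (Teichmueller) section of the reduction \<open>\<int>/9 \<rightarrow> \<int>/3\<close>: it cubes the integer
  representative.  By \<open>cube_lift_of_int\<close> below the choice of representative is immaterial.\<close>

definition cube_lift :: "3 \<Rightarrow> 9" where
  "cube_lift x = of_int (Rep_bit1 x ^ 3)"

lemma cube_lift_of_int: "cube_lift (of_int k) = of_int (k ^ 3)"
proof -
  define m where "m = k div 3"
  define r where "r = k mod 3"
  have "k = 3 * m + r" by (simp add: m_def r_def)
  then have "k ^ 3 = r ^ 3 + 9 * (3 * m ^ 3 + 3 * m ^ 2 * r + m * r ^ 2)"
    by (simp add: power2_eq_square power3_eq_cube algebra_simps)
  then have "r ^ 3 mod 9 = k ^ 3 mod 9" by (simp only: mod_mult_self2)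
  then show ?thesis
    by (simp only: cube_lift_def Rep_of_int_3 of_int_9_eq_iff flip: r_def)
qed

lemma red_cube_lift: "red_9_3 (cube_lift x) = x"
proof -
  obtain k where x: "x = of_int k" by (metis of_int_Rep_3)
  have "k mod 3 = 0 \<or> k mod 3 = 1 \<or> k mod 3 = 2" by presburger
  then have "(k mod 3) ^ 3 mod 3 = k mod 3" by auto
  then have "k ^ 3 mod 3 = k mod 3" by (simp only: power_mod)
  then show ?thesis by (simp only: x cube_lift_of_int red_9_3_of_int of_int_3_eq_iff)
qed

text \<open>The section fails to be additive by the \<open>2\<close>-cocycle \<open>-pq(p + q)\<close> on the group \<open>\<int>/3\<close>, which
  therefore classifies the extension \<open>\<int>/9\<close> of \<open>\<int>/3\<close> by \<open>\<int>/3\<close>.\<close>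

lemma cube_lift_add:
  "cube_lift q - cube_lift (p + q) + cube_lift p = incl_3_9 (- (p * q ^ 2 + p ^ 2 * q))"
proof -
  obtain k l where kl: "p = of_int k" "q = of_int l" by (metis of_int_Rep_3)
  have "cube_lift q - cube_lift (p + q) + cube_lift p = of_int (l ^ 3 - (k + l) ^ 3 + k ^ 3)"
    by (simp only: kl cube_lift_of_int flip: of_int_add of_int_diff)
  also have "l ^ 3 - (k + l) ^ 3 + k ^ 3 = 3 * (- (k * l ^ 2 + k ^ 2 * l))"
    by (simp add: power2_eq_square power3_eq_cube algebra_simps)
  also have "of_int (3 * (- (k * l ^ 2 + k ^ 2 * l))) = incl_3_9 (- (p * q ^ 2 + p ^ 2 * q))"
    by (simp only: kl incl_3_9_of_int flip: of_int_add of_int_minus of_int_mult of_int_power)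
  finally show ?thesis .
qed

theorem proposition9p3:
  fixes X :: "'a delta_data" and u :: "('a \<Rightarrow> 3) set"
  assumes "delta_set X"
    and "u \<in> carrier (cohomology_group X 1)"
  shows "inv\<^bsub>cohomology_group X 2\<^esub> (bockstein X 1 u) \<in> massey3 X u u u"
proof -
  interpret delta_set X by (rule assms(1))
  obtain a where a: "a \<in> cocycles X 1" and u: "u = coh_class X 1 a"
    using assms(2) by (auto simp: carrier_cohomology_group)
  have a0: "a x = 0" if "x \<notin> simplices X 1" for x
    using a that by (simp add: cocycles_def cochains_def)
  define s where "s = (\<lambda>x. a x ^ 2)"
  define m where "m = (\<lambda>x. cup X 1 1 a s x + cup X 1 1 s a x)"
  define c where "c = cube_lift \<circ> a"
  have s: "s \<in> cochains X 1" by (simp add: s_def cochains_def a0)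
  have ds: "cobd X 1 s = cup X 1 1 a a" unfolding s_def by (rule cobd_square[OF a])
  have m: "(\<lambda>x. - m x) \<in> cochains X (Suc 1)"
    using cochains_uminus[OF cochains_add[OF cup_in_cochains cup_in_cochains], of X 1 1]
    by (simp add: m_def)
  have c: "c \<in> cochains X 1"
    using cube_lift_of_int[of 0] by (simp add: c_def cochains_def a0)
  have ca: "red_9_3 \<circ> c = a" by (simp add: c_def fun_eq_iff red_cube_lift)
  have dc: "cobd X 1 c = incl_3_9 \<circ> (\<lambda>x. - m x)"
  proof
    fix x
    show "cobd X 1 c x = (incl_3_9 \<circ> (\<lambda>x. - m x)) x"
    proof (cases "x \<in> simplices X 2")
      case True
      show ?thesis
        by (simp only: cobd_1[OF True] cup_1_1[OF True] cocycle_1[OF a True] comp_apply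
            c_def m_def s_def cube_lift_add)
    next
      case False
      then show ?thesis
        using incl_3_9_of_int[of 0] by (simp add: cobd_def cup_def m_def numeral_2_eq_2)
    qed
  qed
  have "inv\<^bsub>cohomology_group X 2\<^esub> (bockstein X 1 u) = coh_class X 2 m"
    using inv_coh_class[OF bockstein_eqI(1)[OF a c m ca dc]] bockstein_eqI(2)[OF a c m ca dc]
    by (simp add: u numeral_2_eq_2)
  also have "\<dots> \<in> massey3 X u u u"
    unfolding massey3_def m_def using a s ds u by blast
  finally show ?thesis .
qed

end
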